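(* Let $C$ be an $(n,2)_q$-MDS code over an alphabet $\mathcal{A}$ of size $q$ with $0\in\mathcal{A}$, and suppose that $C$ contains the all-zero codeword $\bar 0$. Let $W(C)$ denote the set of Hamming weights of the codewords of $C$ other than $\bar 0$. (1) If $n<q+1$, then $W(C)=\{n,n-1\}$. (2) If $n=q+1$, then $W(C)=\{n-1\}$.
   Context: Let $\mathcal{A}$ be a finite alphabet of size $q\ge 2$ ($q$ need not be a prime power) containing a distinguished symbol $0$, and let $n\ge 2$ be an integer. The Hamming distance $d(a,b)$ of $a,b\in\mathcal{A}^n$ is the number of coordinates in which they differ. An $(n,2)_q$ code is a subset $C\subseteq\mathcal{A}^n$ with $|C|=q^2$; no linearity is assumed. Its minimum distance $d$ is the minimum Hamming distance between distinct codewords; it satisfies the Singleton bound $d\le n-1$, and $C$ is called an $(n,2)_q$-MDS code if $d=n-1$. The Hamming weight of a word is the number of its nonzero coordinates, and $\bar 0$ is the word with all coordinates $0$. *)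

theory Defs imports Main begin

definition words :: "'a set \<Rightarrow> nat \<Rightarrow> 'a list set" where
  "words A n = {a. set a \<subseteq> A \<and> length a = n}"

text \<open>Only meaningful for words of equal length, which is the only way it is used below.\<close>

definition hamming_dist :: "'a list \<Rightarrow> 'a list \<Rightarrow> nat" where
  "hamming_dist a b = card {i. i < length a \<and> a ! i \<noteq> b ! i}"

definition hamming_weight :: "'a \<Rightarrow> 'a list \<Rightarrow> nat" where
  "hamming_weight z a = card {i. i < length a \<and> a ! i \<noteq> z}"

text \<open>For \<open>min_dist\<close> the code has to be finite with at least two codewords; otherwise the
  value of \<open>Min\<close> is unspecified.\<close>

definition min_dist :: "'a list set \<Rightarrow> nat" where
  "min_dist C = Min {hamming_dist a b | a b. a \<in> C \<and> b \<in> C \<and> a \<noteq> b}"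

definition code2 :: "'a set \<Rightarrow> nat \<Rightarrow> 'a list set \<Rightarrow> bool" where
  "code2 A n C \<longleftrightarrow> C \<subseteq> words A n \<and> card C = (card A)\<^sup>2"

definition mds_code2 :: "'a set \<Rightarrow> nat \<Rightarrow> 'a list set \<Rightarrow> bool" where
  "mds_code2 A n C \<longleftrightarrow> code2 A n C \<and> min_dist C = n - 1"

definition zero_word :: "'a \<Rightarrow> nat \<Rightarrow> 'a list" where
  "zero_word z n = replicate n z"

definition nonzero_weights :: "'a \<Rightarrow> nat \<Rightarrow> 'a list set \<Rightarrow> nat set" where
  "nonzero_weights z n C = hamming_weight z ` (C - {zero_word z n})"

end

theory Submission imports Defs begin

text \<open>Two distinct codewords agree in at most one coordinate, so projecting the code to any two
  coordinates is a bijection onto \<open>A \<times> A\<close>. Hence exactly \<open>q - 1\<close> nonzero codewords vanish at a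
  given coordinate, and no nonzero codeword vanishes at two coordinates. Of the
  \<open>(q - 1) * (q + 1)\<close> nonzero codewords, \<open>n * (q - 1)\<close> therefore have weight \<open>n - 1\<close>, and the
  others have weight \<open>n\<close>.\<close>

lemma finite_words: "finite A \<Longrightarrow> finite (words A n)"
  unfolding words_def by (rule finite_lists_length_eq)

lemma min_dist_le:
  assumes "finite C" "a \<in> C" "b \<in> C" "a \<noteq> b"
  shows "min_dist C \<le> hamming_dist a b"
proof -
  have "{hamming_dist a b | a b. a \<in> C \<and> b \<in> C \<and> a \<noteq> b}
      \<subseteq> (\<lambda>(a, b). hamming_dist a b) ` (C \<times> C)"
    by auto
  then have "finite {hamming_dist a b | a b. a \<in> C \<and> b \<in> C \<and> a \<noteq> b}"
    by (rule finite_subset) (simp add: assms(1))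
  then show ?thesis
    unfolding min_dist_def using assms(2-) by (intro Min_le) auto
qed

text \<open>Agreement at both \<open>i\<close> and \<open>j\<close> would leave distinct codewords
  at distance at most \<open>n - 2\<close>, below the minimum distance \<open>n - 1\<close>. The two
  distinct indices force n \<ge> 2, so truncated subtraction does no harm.\<close>

lemma mds_code2_eqI:
  assumes "finite A" "mds_code2 A n C" "a \<in> C" "b \<in> C"
    and "i < n" "j < n" "i \<noteq> j" "a ! i = b ! i" "a ! j = b ! j"
  shows "a = b"
proof (rule ccontr)
  assume "a \<noteq> b"
  have sub: "C \<subseteq> words A n" and md: "min_dist C = n - 1"
    using assms(2) by (auto simp: mds_code2_def code2_def)
  have "finite C"
    using sub finite_words[OF assms(1)] by (rule finite_subset)
  then have "n - 1 \<le> hamming_dist a b"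
    using min_dist_le[of C a b] assms(3,4) \<open>a \<noteq> b\<close> md by simp
  also have "\<dots> \<le> card ({..<n} - {i, j})"
    unfolding hamming_dist_def using sub assms(3-) by (intro card_mono) (auto simp: words_def)
  also have "\<dots> = n - 2"
    using assms(5-7) by (simp add: card_Diff_subset)
  finally show False
    using assms(5-7) by linarith
qed

text \<open>Injectivity is the previous lemma. Surjectivity is a count: the image lies in
  \<open>A \<times> A\<close> and already has as many elements, because \<open>card C\<close> is the
  square of \<open>card A\<close>.\<close>

lemma mds_code2_projection_bij:
  assumes "finite A" "mds_code2 A n C" "i < n" "j < n" "i \<noteq> j"
  shows "bij_betw (\<lambda>c. (c ! i, c ! j)) C (A \<times> A)"
proof -
  have sub: "C \<subseteq> words A n" and card: "card C = (card A)\<^sup>2"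
    using assms(2) by (auto simp: mds_code2_def code2_def)
  have inj: "inj_on (\<lambda>c. (c ! i, c ! j)) C"
    using mds_code2_eqI[OF assms(1,2) _ _ assms(3-5)] by (auto intro!: inj_onI)
  have "(\<lambda>c. (c ! i, c ! j)) ` C \<subseteq> A \<times> A"
    using sub assms(3,4) by (auto simp: words_def subset_iff)
  then have "(\<lambda>c. (c ! i, c ! j)) ` C = A \<times> A"
    using assms(1) card card_image[OF inj]
    by (intro card_subset_eq) (auto simp: card_cartesian_product power2_eq_square)
  with inj show ?thesis
    by (simp add: bij_betw_def)
qed

lemma mds_code2_card_fiber:
  assumes "finite A" "mds_code2 A n C" "n \<ge> 2" "i < n" "x \<in> A"
  shows "card {c \<in> C. c ! i = x} = card A"
proof -
  \<comment> \<open>Any second coordinate will do; with it, the fiber over \<open>x\<close>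
    corresponds to \<open>{x} \<times> A\<close>.\<close>
  obtain j where j: "j < n" "i \<noteq> j"
    using assms(3) that[of "if i = 0 then 1 else 0"] by (auto split: if_splits)
  let ?p = "\<lambda>c. (c ! i, c ! j)"
  have bij: "bij_betw ?p C (A \<times> A)"
    using mds_code2_projection_bij assms(1,2,4) j by blast
  have "?p ` {c \<in> C. c ! i = x} = {p \<in> ?p ` C. fst p = x}"
    by auto
  also have "\<dots> = {x} \<times> A"
    using bij_betw_imp_surj_on[OF bij] assms(5) by auto
  finally have "bij_betw ?p {c \<in> C. c ! i = x} ({x} \<times> A)"
    by (intro bij_betw_subset[OF bij]) auto
  then show ?thesis
    by (auto dest: bij_betw_same_card simp: card_cartesian_product)
qed

lemma hamming_weight_eq_length:
  assumes "length c = n" "\<forall>i<n. c ! i \<noteq> z"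
  shows "hamming_weight z c = n"
proof -
  have "{i. i < length c \<and> c ! i \<noteq> z} = {..<n}"
    using assms by auto
  then show ?thesis
    by (simp add: hamming_weight_def)
qed

lemma hamming_weight_unique_zero:
  assumes "length c = n" "i < n" "\<forall>j<n. c ! j = z \<longleftrightarrow> j = i"
  shows "hamming_weight z c = n - 1"
proof -
  have "{j. j < length c \<and> c ! j \<noteq> z} = {..<n} - {i}"
    using assms by auto
  then show ?thesis
    using assms(2) by (simp add: hamming_weight_def)
qed

theorem theorem5:
  fixes A :: "'a set" and zero :: 'a and q n :: nat and C :: "'a list set"
  assumes "finite A" and "card A = q" and "q \<ge> 2" and "zero \<in> A"
    and "n \<ge> 2"
    and "mds_code2 A n C"
    and "zero_word zero n \<in> C"
  shows "(n < q + 1 \<longrightarrow> nonzero_weights zero n C = {n, n - 1}) \<and>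
         (n = q + 1 \<longrightarrow> nonzero_weights zero n C = {n - 1})"
proof -
  define N where "N = C - {zero_word zero n}"
  define Z where "Z i = {c \<in> N. c ! i = zero}" for i
  define U where "U = (\<Union>i<n. Z i)"
  have sub: "C \<subseteq> words A n" and card_C: "card C = q\<^sup>2"
    using assms(2,6) by (auto simp: mds_code2_def code2_def)
  have fin: "finite C"
    using sub finite_words[OF assms(1)] by (rule finite_subset)
  have len: "length c = n" if "c \<in> N" for c
    using that sub by (auto simp: N_def words_def)
  \<comment> \<open>Factored to share \<open>q - 1\<close> with \<open>card_U\<close>, so that
    comparing \<open>U\<close> with \<open>N\<close> becomes comparing \<open>n\<close> with
    \<open>q + 1\<close>.\<close>
  have card_N: "card N = (q - 1) * (q + 1)"
    using fin assms(7) card_C by (simp add: N_def power2_eq_square algebra_simps)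
  have card_Z: "card (Z i) = q - 1" if "i < n" for i
  proof -
    \<comment> \<open>The zero word is one of the \<open>q\<close> codewords in the fiber over
      \<open>zero\<close>.\<close>
    have "Z i = {c \<in> C. c ! i = zero} - {zero_word zero n}"
      by (auto simp: Z_def N_def)
    moreover have "zero_word zero n \<in> {c \<in> C. c ! i = zero}"
      using assms(7) that by (simp add: zero_word_def)
    ultimately show ?thesis
      using mds_code2_card_fiber[OF assms(1,6,5) that assms(4)] assms(2) fin by simp
  qed
  \<comment> \<open>A zero of \<open>c\<close> is an agreement with the zero word, itself a
    codeword; two of them would make \<open>c\<close> the zero word.\<close>
  have unique_zero: "i = j" if "c \<in> N" "i < n" "j < n" "c ! i = zero" "c ! j = zero" for c i j
    using mds_code2_eqI[OF assms(1,6) _ assms(7) that(2,3), of c] that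
    by (auto simp: N_def zero_word_def)
  \<comment> \<open>By \<open>unique_zero\<close> the sets \<open>Z i\<close> are pairwise
    disjoint.\<close>
  have "card U = (\<Sum>i<n. card (Z i))"
    unfolding U_def using fin unique_zero by (intro card_UN_disjoint) (auto simp: Z_def N_def)
  then have card_U: "card U = (q - 1) * n"
    using card_Z by simp
  have "U \<subseteq> N"
    by (auto simp: U_def Z_def)
  \<comment> \<open>Ensures that the weight \<open>n - 1\<close> really occurs, in both
    cases.\<close>
  have "U \<noteq> {}"
    using card_U assms(3,5) by auto
  have weight_U: "hamming_weight zero c = n - 1" if "c \<in> U" for c
  proof -
    obtain i where "i < n" "c \<in> N" "c ! i = zero"
      using \<open>c \<in> U\<close> by (auto simp: U_def Z_def)
    then show ?thesis
      using unique_zero len by (intro hamming_weight_unique_zero[of c n i]) auto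
  qed
  have weight_not_U: "hamming_weight zero c = n" if "c \<in> N - U" for c
    using that len by (intro hamming_weight_eq_length) (auto simp: U_def Z_def)
  have weights: "nonzero_weights zero n C
      = hamming_weight zero ` U \<union> hamming_weight zero ` (N - U)"
    using \<open>U \<subseteq> N\<close> by (auto simp: nonzero_weights_def N_def)
  have image_U: "hamming_weight zero ` U = {n - 1}"
    using weight_U \<open>U \<noteq> {}\<close> by force
  show ?thesis
  proof (intro conjI impI)
    assume "n < q + 1"
    then have "card U < card N"
      unfolding card_U card_N using assms(3) by (intro mult_strict_left_mono) auto
    then have "N - U \<noteq> {}"
      using \<open>U \<subseteq> N\<close> by auto
    then have "hamming_weight zero ` (N - U) = {n}"
      using weight_not_U by force
    then show "nonzero_weights zero n C = {n, n - 1}"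
      using weights image_U by auto
  next
    assume "n = q + 1"
    \<comment> \<open>The cardinalities now coincide: every nonzero codeword has a zero coordinate,
      which rules out weight \<open>n\<close>.\<close>
    then have "U = N"
      using card_U card_N \<open>U \<subseteq> N\<close> fin by (intro card_subset_eq) (auto simp: N_def)
    then show "nonzero_weights zero n C = {n - 1}"
      using weights image_U by simp
  qed
qed

end
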